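(* Let $A$ and $B$ be groups, let $B$ act (not necessarily effectively) on a set $X$, and let $\varphi\colon B\to\Sigma(X)$ be the corresponding homomorphism to the permutation group of $X$. Let $\mathcal{O}$ be the set of all orbits of $B$ on $X$ and $\mathcal{O}_{fin}$ the set of finite orbits. Then $$Z(A\ Wr_X\, B)=\tilde D(A)\times(\ker\varphi\cap Z(B))\cong\prod_{\lambda\in\mathcal{O}}Z(A)\times(\ker\varphi\cap Z(B)),$$ $$Z(A\ wr_X\, B)=D(A)\times(\ker\varphi\cap Z(B))\cong\bigoplus_{\lambda\in\mathcal{O}_{fin}}Z(A)\times(\ker\varphi\cap Z(B)).$$
   Context: $Z(\cdot)$ denotes the center of a group. For $b\in B$, $\varphi_b\colon X\to X$ is the permutation corresponding to $b$. $Map(X,A)$ is the group of all maps $X\to A$ under pointwise multiplication; $b\in B$ acts on it by $f\mapsto f\circ\varphi_b$. The unrestricted wreath product $A\ Wr_X\,B$ is the semidirect product $Map(X,A)\rtimes_\varphi B$, i.e. the set $Map(X,A)\times B$ with multiplication $$(f_1,b_1)\cdot(f_2,b_2)=\bigl((f_1\circ\varphi_{b_2})\cdot f_2,\ b_1b_2\bigr).$$ Let $Map_{fin}(X,A)\subset Map(X,A)$ be the subgroup of functions $f$ with finite support $\sigma(f)=\{x\in X: f(x)\ne e\}$, where $e$ is the unit of $A$. The restricted wreath product $A\ wr_X\,B$ is the semidirect product $Map_{fin}(X,A)\rtimes_\varphi B$ (same multiplication). $\tilde D(A)$ denotes the group of functions $h\colon X\to Z(A)$ that are constant on each orbit of $B$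 on $X$, and $D(A)$ the group of functions $h\in Map_{fin}(X,Z(A))$ with the same property. The direct product over an index set consists of all families, the direct sum of families with only finitely many nontrivial entries. The equalities are equalities of subgroups, with $\tilde D(A)\times(\ker\varphi\cap Z(B))$ and $D(A)\times(\ker\varphi\cap Z(B))$ denoting the sets of pairs $(f,l)$ with $f$ in the first factor and $l$ in the second.
   Formalization: The formal statement assumes that A is nontrivial or Z(B) is contained in ker φ; without this the equalities fail, e.g. for A trivial and B = Z/2 swapping two points, where the center is all of B but ker φ ∩ Z(B) is trivial. *)

theory Defs
  imports "HOL-Algebra.Group_Action" "HOL-Algebra.Product_Groups"
begin

definition center :: "('a, 'm) monoid_scheme \<Rightarrow> 'a set" where
  "center G = {z \<in> carrier G. \<forall>g \<in> carrier G. z \<otimes>\<^bsub>G\<^esub> g = g \<otimes>\<^bsub>G\<^esub> z}"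

text \<open>
  Maps on \<open>X\<close> are represented by extensional functions, so the group of all maps \<open>X \<rightarrow> A\<close>
  and its subgroup of finitely supported maps are the library's \<^const>\<open>product_group\<close> and
  \<^const>\<open>sum_group\<close> of the constant family \<open>A\<close>.

  Semidirect product of a group \<open>N\<close> of maps on \<open>X\<close> with \<open>B\<close>, where \<open>b\<close> acts on \<open>N\<close> from the
  right by precomposition with the permutation \<open>\<phi> b\<close> of \<open>X\<close>.
\<close>

definition map_semidirect ::
  "('x \<Rightarrow> 'a, 'k) monoid_scheme \<Rightarrow> ('b, 'm) monoid_scheme \<Rightarrow> 'x set \<Rightarrow> ('b \<Rightarrow> 'x \<Rightarrow> 'x)
    \<Rightarrow> (('x \<Rightarrow> 'a) \<times> 'b) monoid" where
  "map_semidirect N B X \<phi> =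
    \<lparr>carrier = carrier N \<times> carrier B,
     mult = (\<lambda>(f1, b1) (f2, b2). (compose X f1 (\<phi> b2) \<otimes>\<^bsub>N\<^esub> f2, b1 \<otimes>\<^bsub>B\<^esub> b2)),
     one = (\<one>\<^bsub>N\<^esub>, \<one>\<^bsub>B\<^esub>)\<rparr>"

definition unrestricted_wreath ::
  "('a, 'k) monoid_scheme \<Rightarrow> ('b, 'm) monoid_scheme \<Rightarrow> 'x set \<Rightarrow> ('b \<Rightarrow> 'x \<Rightarrow> 'x)
    \<Rightarrow> (('x \<Rightarrow> 'a) \<times> 'b) monoid" where
  "unrestricted_wreath A B X \<phi> = map_semidirect (product_group X (\<lambda>_. A)) B X \<phi>"

definition restricted_wreath ::
  "('a, 'k) monoid_scheme \<Rightarrow> ('b, 'm) monoid_scheme \<Rightarrow> 'x set \<Rightarrow> ('b \<Rightarrow> 'x \<Rightarrow> 'x)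
    \<Rightarrow> (('x \<Rightarrow> 'a) \<times> 'b) monoid" where
  "restricted_wreath A B X \<phi> = map_semidirect (sum_group X (\<lambda>_. A)) B X \<phi>"

definition center_group :: "('a, 'm) monoid_scheme \<Rightarrow> ('a, 'm) monoid_scheme" where
  "center_group G = G\<lparr>carrier := center G\<rparr>"

definition D_tilde ::
  "('a, 'k) monoid_scheme \<Rightarrow> ('b, 'm) monoid_scheme \<Rightarrow> 'x set \<Rightarrow> ('b \<Rightarrow> 'x \<Rightarrow> 'x)
    \<Rightarrow> ('x \<Rightarrow> 'a) set" where
  "D_tilde A B X \<phi> = {h \<in> carrier (product_group X (\<lambda>_. center_group A)).
     \<forall>\<omega> \<in> orbits B X \<phi>. \<forall>x \<in> \<omega>. \<forall>y \<in> \<omega>. h x = h y}"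

definition D_fin ::
  "('a, 'k) monoid_scheme \<Rightarrow> ('b, 'm) monoid_scheme \<Rightarrow> 'x set \<Rightarrow> ('b \<Rightarrow> 'x \<Rightarrow> 'x)
    \<Rightarrow> ('x \<Rightarrow> 'a) set" where
  "D_fin A B X \<phi> = {h \<in> carrier (sum_group X (\<lambda>_. center_group A)).
     \<forall>\<omega> \<in> orbits B X \<phi>. \<forall>x \<in> \<omega>. \<forall>y \<in> \<omega>. h x = h y}"

definition finite_orbits ::
  "('b, 'm) monoid_scheme \<Rightarrow> 'x set \<Rightarrow> ('b \<Rightarrow> 'x \<Rightarrow> 'x) \<Rightarrow> 'x set set" where
  "finite_orbits B X \<phi> = {\<omega> \<in> orbits B X \<phi>. finite \<omega>}"

definition ker_center ::
  "('b, 'm) monoid_scheme \<Rightarrow> 'x set \<Rightarrow> ('b \<Rightarrow> 'x \<Rightarrow> 'x) \<Rightarrow> 'b set" where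
  "ker_center B X \<phi> = kernel B (BijGroup X) \<phi> \<inter> center B"

end

theory Submission
  imports Defs
begin

text \<open>
  Comparing \<open>(f, b) \<cdot> (g, c)\<close> with \<open>(g, c) \<cdot> (f, b)\<close> shows that \<open>(f, b)\<close> is central iff \<open>b\<close> is
  central and \<open>(f \<circ> \<phi> c) \<cdot> g = (g \<circ> \<phi> b) \<cdot> f\<close> for all \<open>g\<close> and \<open>c\<close>. Taking \<open>g\<close> trivial makes \<open>f\<close>
  constant on orbits; taking \<open>g\<close> supported at a single point moved by \<open>\<phi> b\<close> gives a contradiction
  as soon as \<open>A\<close> is nontrivial (for trivial \<open>A\<close>, that \<open>\<phi> b\<close> is trivial has to be assumed).
  So \<open>\<phi> b\<close> is the identity, and then the values of \<open>f\<close> are central.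
  Only finitely supported \<open>g\<close> are used, so both wreath products are covered at once.
  A function constant on orbits is a function of the orbit, and it has finite support iff it
  vanishes on the infinite orbits and on all but finitely many of the finite ones.
\<close>

section \<open>The center of a group\<close>

lemma center_commute:
  "z \<in> center G \<Longrightarrow> g \<in> carrier G \<Longrightarrow> z \<otimes>\<^bsub>G\<^esub> g = g \<otimes>\<^bsub>G\<^esub> z"
  by (simp add: center_def)

lemma center_subset: "center G \<subseteq> carrier G"
  by (auto simp: center_def)

lemma centerI:
  assumes "z \<in> carrier G" "\<And>g. g \<in> carrier G \<Longrightarrow> z \<otimes>\<^bsub>G\<^esub> g = g \<otimes>\<^bsub>G\<^esub> z"
  shows "z \<in> center G"
  unfolding center_def using assms by blast

lemma (in group) subgroup_center: "subgroup (center G) G"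
proof (rule subgroupI)
  show "center G \<subseteq> carrier G"
    by (rule center_subset)
  have "\<one> \<in> center G"
    by (rule centerI) simp_all
  then show "center G \<noteq> {}"
    by blast
next
  fix z assume z: "z \<in> center G"
  have zG: "z \<in> carrier G"
    using center_subset z by (rule subsetD)
  show "inv z \<in> center G"
  proof (rule centerI)
    fix g assume g: "g \<in> carrier G"
    \<comment> \<open>The relation is obtained by inverting the one between \<open>z\<close> and
      \<open>inv g\<close>.\<close>
    have "inv z \<otimes> g = inv (inv g \<otimes> z)"
      using g zG by (simp add: inv_mult_group)
    also have "\<dots> = inv (z \<otimes> inv g)"
      using center_commute[OF z inv_closed[OF g]] by metis
    also have "\<dots> = g \<otimes> inv z"
      using g zG by (simp add: inv_mult_group)
    finally show "inv z \<otimes> g = g \<otimes> inv z" .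
  qed (use zG in simp)
next
  fix y z assume y: "y \<in> center G" and z: "z \<in> center G"
  have yG: "y \<in> carrier G" and zG: "z \<in> carrier G"
    using y z by (auto intro: subsetD[OF center_subset])
  show "y \<otimes> z \<in> center G"
  proof (rule centerI)
    fix g assume g: "g \<in> carrier G"
    have "y \<otimes> z \<otimes> g = y \<otimes> (g \<otimes> z)"
      using yG zG g by (simp add: m_assoc center_commute[OF z g])
    also have "\<dots> = g \<otimes> y \<otimes> z"
      using yG zG g by (simp add: center_commute[OF y g] flip: m_assoc)
    also have "\<dots> = g \<otimes> (y \<otimes> z)"
      using yG zG g by (simp add: m_assoc)
    finally show "y \<otimes> z \<otimes> g = g \<otimes> (y \<otimes> z)" .
  qed (use yG zG in simp)
qed

lemma carrier_center_group [simp]: "carrier (center_group G) = center G"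
  and mult_center_group [simp]: "(\<otimes>\<^bsub>center_group G\<^esub>) = (\<otimes>\<^bsub>G\<^esub>)"
  and one_center_group [simp]: "\<one>\<^bsub>center_group G\<^esub> = \<one>\<^bsub>G\<^esub>"
  by (simp_all add: center_group_def)

lemma (in group) group_center_group [simp]: "group (center_group G)"
  unfolding center_group_def by (rule subgroup.subgroup_is_group[OF subgroup_center is_group])

section \<open>Semidirect products and the kernel of the action\<close>

lemma carrier_map_semidirect [simp]:
  "carrier (map_semidirect N B X \<phi>) = carrier N \<times> carrier B"
  by (simp add: map_semidirect_def)

lemma mult_map_semidirect [simp]:
  "(f1, b1) \<otimes>\<^bsub>map_semidirect N B X \<phi>\<^esub> (f2, b2) =
    (compose X f1 (\<phi> b2) \<otimes>\<^bsub>N\<^esub> f2, b1 \<otimes>\<^bsub>B\<^esub> b2)"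
  by (simp add: map_semidirect_def)

text \<open>The unit of \<open>BijGroup X\<close> is the identity on \<open>X\<close>, undefined
  elsewhere, hence the restricted lambda. Membership in the carrier is already part of being
  central.\<close>

lemma ker_center_iff:
  "b \<in> ker_center B X \<phi> \<longleftrightarrow> b \<in> center B \<and> \<phi> b = (\<lambda>x\<in>X. x)"
  by (auto simp: ker_center_def kernel_def BijGroup_def center_def)

section \<open>Orbits and functions constant on them\<close>

context group_action
begin

lemma orbit_eqI:
  assumes "x \<in> E" "y \<in> orbit G \<phi> x"
  shows "orbit G \<phi> y = orbit G \<phi> x"
proof -
  have sub: "z \<in> E" if "w \<in> E" "z \<in> orbit G \<phi> w" for w z
    using that element_image by (auto simp: orbit_def)
  have y: "y \<in> E" and x: "x \<in> orbit G \<phi> y"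
    using assms sub orbit_sym by blast+
  show ?thesis
    using orbit_trans sub assms x y by blast
qed

lemma orbits_memD:
  assumes "\<omega> \<in> orbits G E \<phi>" "x \<in> \<omega>"
  shows "x \<in> E" "orbit G \<phi> x = \<omega>"
proof -
  show "x \<in> E"
    using assms orbits_coverture by blast
  show "orbit G \<phi> x = \<omega>"
    using assms orbit_eqI by (auto simp: orbits_def)
qed

text \<open>Orbits are nonempty, so choice supplies a representative at which a function of points
  is read as a function of orbits.\<close>

lemma orbits_someI:
  assumes "\<omega> \<in> orbits G E \<phi>"
  shows "(SOME x. x \<in> \<omega>) \<in> \<omega>"
proof -
  obtain x where "x \<in> \<omega>"
    using assms orbit_refl by (auto simp: orbits_def)
  then show ?thesis
    by (rule someI)
qed

text \<open>Every point of an orbit is a translate of its base point, so constancy on orbits becomes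
  invariance under each \<open>\<phi> g\<close>, the form that commutation relations
  deliver.\<close>

lemma D_tilde_iff:
  "h \<in> D_tilde A G E \<phi> \<longleftrightarrow>
    h \<in> E \<rightarrow>\<^sub>E center A \<and> (\<forall>x\<in>E. \<forall>g\<in>carrier G. h (\<phi> g x) = h x)"
proof -
  have "(\<forall>\<omega>\<in>orbits G E \<phi>. \<forall>x\<in>\<omega>. \<forall>y\<in>\<omega>. h x = h y) \<longleftrightarrow>
        (\<forall>x\<in>E. \<forall>g\<in>carrier G. h (\<phi> g x) = h x)"  (is "?L \<longleftrightarrow> ?R")
  proof
    assume L: ?L
    show ?R
    proof (intro ballI)
      fix x g assume "x \<in> E" "g \<in> carrier G"
      then have "orbit G \<phi> x \<in> orbits G E \<phi>" "x \<in> orbit G \<phi> x" "\<phi> g x \<in> orbit G \<phi> x"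
        using orbit_refl by (auto simp: orbits_def orbit_def)
      with L show "h (\<phi> g x) = h x"
        by blast
    qed
  next
    assume ?R
    then show ?L
      by (auto simp: orbits_def orbit_def)
  qed
  then show ?thesis
    by (simp add: D_tilde_def)
qed

text \<open>\<open>sum_group\<close> is a generated subgroup; its carrier is read off as the
  finitely supported families because \<open>center_group A\<close> is a group.\<close>

lemma D_fin_eq:
  assumes "group A"
  shows "D_fin A G E \<phi> = D_tilde A G E \<phi> \<inter> {h. finite {x\<in>E. h x \<noteq> \<one>\<^bsub>A\<^esub>}}"
  by (auto simp: D_fin_def D_tilde_def carrier_sum_group group.group_center_group[OF assms])

lemma D_tilde_orbit_eq:
  assumes "h \<in> D_tilde A G E \<phi>" "\<omega> \<in> orbits G E \<phi>" "x \<in> \<omega>" "y \<in> \<omega>"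
  shows "h x = h y"
  using assms unfolding D_tilde_def by blast

section \<open>The center of the semidirect product\<close>

text \<open>Letting \<open>N\<close> be anything between the finitely supported maps and all maps
  covers both wreath products. If \<open>A\<close> is trivial, the semidirect product is a copy of
  \<open>G\<close>, whose center may act nontrivially; \<open>nondegenerate\<close> excludes
  this.\<close>

lemma center_map_semidirect:
  assumes "group A"
    and nondegenerate: "carrier A \<noteq> {\<one>\<^bsub>A\<^esub>} \<or> center G \<subseteq> kernel G (BijGroup E) \<phi>"
    and mult_N: "(\<otimes>\<^bsub>N\<^esub>) = (\<lambda>f g. \<lambda>x\<in>E. f x \<otimes>\<^bsub>A\<^esub> g x)"
    and sum_N: "carrier (sum_group E (\<lambda>_. A)) \<subseteq> carrier N"
    and N_prod: "carrier N \<subseteq> carrier (product_group E (\<lambda>_. A))"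
  shows "center (map_semidirect N G E \<phi>) = (D_tilde A G E \<phi> \<inter> carrier N) \<times> ker_center G E \<phi>"
proof -
  interpret A: group A by fact
  interpret G: group G
    using group_hom group_hom.axioms(1) by auto
  have central_iff: "(f, b) \<in> center (map_semidirect N G E \<phi>) \<longleftrightarrow>
      f \<in> carrier N \<and> b \<in> carrier G \<and> (\<forall>g\<in>carrier N. \<forall>c\<in>carrier G.
        (\<forall>x\<in>E. f (\<phi> c x) \<otimes>\<^bsub>A\<^esub> g x = g (\<phi> b x) \<otimes>\<^bsub>A\<^esub> f x) \<and> b \<otimes> c = c \<otimes> b)" for f b
  proof -
    \<comment> \<open>Products in \<open>N\<close> are restricted to \<open>E\<close>, so first
      components need to be compared only pointwise on \<open>E\<close>.\<close>
    have mult_eq_iff: "(f, b) \<otimes>\<^bsub>map_semidirect N G E \<phi>\<^esub> (g, c) =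
      (g, c) \<otimes>\<^bsub>map_semidirect N G E \<phi>\<^esub> (f, b)
      \<longleftrightarrow> (\<forall>x\<in>E. f (\<phi> c x) \<otimes>\<^bsub>A\<^esub> g x = g (\<phi> b x) \<otimes>\<^bsub>A\<^esub> f x) \<and> b \<otimes> c = c \<otimes> b" for g c
      by (simp add: mult_N compose_def restrict_def fun_eq_iff Ball_def)
    show ?thesis
      unfolding center_def mem_Collect_eq carrier_map_semidirect split_paired_Ball_Sigma mult_eq_iff
      by blast
  qed
  have f_val: "f x \<in> carrier A" if "f \<in> carrier N" "x \<in> E" for f x
    using that N_prod by (auto simp: PiE_iff)
  have one_N: "(\<lambda>x\<in>E. \<one>\<^bsub>A\<^esub>) \<in> carrier N"
    using sum_N by (auto simp: carrier_sum_group)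
  \<comment> \<open>Test functions with at most one nontrivial value: finite support puts them into
    every admissible \<open>N\<close>.\<close>
  have delta_N: "(\<lambda>x\<in>E. if x = y then a else \<one>\<^bsub>A\<^esub>) \<in> carrier N" if "a \<in> carrier A" for a y
  proof -
    have "finite {x \<in> E. (\<lambda>x\<in>E. if x = y then a else \<one>\<^bsub>A\<^esub>) x \<noteq> \<one>\<^bsub>A\<^esub>}"
      by (rule finite_subset[of _ "{y}"]) auto
    then show ?thesis
      using sum_N that by (auto simp: carrier_sum_group)
  qed
  have "f \<in> D_tilde A G E \<phi> \<and> b \<in> ker_center G E \<phi> \<and> f \<in> carrier N"
    if c: "(f, b) \<in> center (map_semidirect N G E \<phi>)" for f b
  proof -
    have fN: "f \<in> carrier N" and bG: "b \<in> carrier G"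
      using c unfolding central_iff by blast+
    \<comment> \<open>Commutation is quantified over pairs, so some element of \<open>N\<close> has
      to accompany \<open>c\<close>; the constant unit serves.\<close>
    have b: "b \<in> center G"
      using c one_N bG unfolding central_iff by (blast intro: centerI)
    have eq: "f (\<phi> c x) \<otimes>\<^bsub>A\<^esub> g x = g (\<phi> b x) \<otimes>\<^bsub>A\<^esub> f x"
      if "g \<in> carrier N" "c \<in> carrier G" "x \<in> E" for g c x
      using c that unfolding central_iff by blast
    have invar: "f (\<phi> c x) = f x" if "c \<in> carrier G" "x \<in> E" for c x
    proof -
      have "\<phi> c x \<in> E" "\<phi> b x \<in> E"
        using that bG element_image by blast+
      then show ?thesis
        using eq[OF one_N that] that by (simp add: f_val[OF fN])
    qed
    \<comment> \<open>Here \<open>c\<close> is the unit of \<open>G\<close>, and invariance removes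
      it from the argument of \<open>f\<close>.\<close>
    have comm: "f x \<otimes>\<^bsub>A\<^esub> g x = g (\<phi> b x) \<otimes>\<^bsub>A\<^esub> f x" if "g \<in> carrier N" "x \<in> E" for g x
      using eq[OF that(1) G.one_closed that(2)] invar[OF G.one_closed that(2)] by simp
    have fixed: "\<phi> b x = x" if x: "x \<in> E" for x
    proof (cases "carrier A = {\<one>\<^bsub>A\<^esub>}")
      case True
      then have "b \<in> kernel G (BijGroup E) \<phi>"
        using nondegenerate b by blast
      then show ?thesis
        using x by (simp add: kernel_def BijGroup_def)
    next
      case False
      then obtain a where a: "a \<in> carrier A" "a \<noteq> \<one>\<^bsub>A\<^esub>"
        using A.one_closed by blast
      show ?thesis
      proof (rule ccontr)
        assume "\<phi> b x \<noteq> x"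
        moreover have "\<phi> b x \<in> E"
          using x bG element_image by blast
        \<comment> \<open>The test function has value \<open>a\<close> at \<open>x\<close>, which
          enters on the left, and the unit at \<open>\<phi> b x\<close>, which enters on the
          right.\<close>
        ultimately have "f x \<otimes>\<^bsub>A\<^esub> a = f x"
          using comm[OF delta_N[OF a(1), of x] x] x f_val[OF fN x] by simp
        then show False
          using a f_val[OF fN x] by simp
      qed
    qed
    \<comment> \<open>Elements of \<open>Bij E\<close> are extensional, so fixing every point of
      \<open>E\<close> determines \<open>\<phi> b\<close> as a function.\<close>
    have "\<phi> b = (\<lambda>x\<in>E. x)"
      using bij_prop0[OF bG] fixed by (auto simp: Bij_def extensional_def fun_eq_iff)
    moreover have "f x \<in> center A" if x: "x \<in> E" for x
      unfolding center_def
    proof (intro CollectI conjI ballI)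
      \<comment> \<open>Since \<open>\<phi> b\<close> now fixes \<open>x\<close>, the test function
        contributes the same value \<open>a\<close> on both sides.\<close>
      fix a assume a: "a \<in> carrier A"
      show "f x \<otimes>\<^bsub>A\<^esub> a = a \<otimes>\<^bsub>A\<^esub> f x"
        using comm[OF delta_N[OF a, of x] x] x by (simp add: fixed)
    qed (rule f_val[OF fN x])
    ultimately show ?thesis
      using fN N_prod b invar by (auto simp: D_tilde_iff ker_center_iff PiE_iff)
  qed
  moreover have "(f, b) \<in> center (map_semidirect N G E \<phi>)"
    if f: "f \<in> D_tilde A G E \<phi>" "f \<in> carrier N" and b: "b \<in> ker_center G E \<phi>" for f b
    unfolding central_iff
  proof (intro conjI ballI)
    have "b \<in> center G"
      using b by (simp add: ker_center_iff)
    then show "b \<in> carrier G" "\<And>c. c \<in> carrier G \<Longrightarrow> b \<otimes> c = c \<otimes> b"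
      by (rule subsetD[OF center_subset], rule center_commute)
    show "f \<in> carrier N"
      by fact
    fix g c x assume "g \<in> carrier N" "c \<in> carrier G" "x \<in> E"
    then have "f x \<in> center A" "f (\<phi> c x) = f x" "\<phi> b x = x" "g x \<in> carrier A"
      using f b f_val by (auto simp: D_tilde_iff ker_center_iff)
    then show "f (\<phi> c x) \<otimes>\<^bsub>A\<^esub> g x = g (\<phi> b x) \<otimes>\<^bsub>A\<^esub> f x"
      using center_commute[of "f x" A "g x"] by simp
  qed
  ultimately show ?thesis
    by auto
qed

section \<open>Isomorphisms with products indexed by orbits\<close>

text \<open>Evaluation at representatives of the orbits in \<open>S\<close> and extension by the
  unit off \<open>S\<close> are mutually inverse, as functions in \<open>H\<close> are trivial off
  \<open>S\<close>. The product becomes direct because \<open>ker_center\<close> acts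
  trivially.\<close>

lemma map_semidirect_iso_DirProd:
  assumes S: "S \<subseteq> orbits G E \<phi>"
    and H: "H \<subseteq> D_tilde A G E \<phi>"
    and H_one: "\<And>h x. h \<in> H \<Longrightarrow> x \<in> E \<Longrightarrow> orbit G \<phi> x \<notin> S \<Longrightarrow> h x = \<one>\<^bsub>A\<^esub>"
    and mult_N: "(\<otimes>\<^bsub>N\<^esub>) = (\<lambda>f g. \<lambda>x\<in>E. f x \<otimes>\<^bsub>A\<^esub> g x)"
    and mult_P: "(\<otimes>\<^bsub>P\<^esub>) = (\<lambda>f g. \<lambda>\<omega>\<in>S. f \<omega> \<otimes>\<^bsub>A\<^esub> g \<omega>)"
    and P: "carrier P \<subseteq> extensional S"
    and H_to_P: "\<And>h. h \<in> H \<Longrightarrow> (\<lambda>\<omega>\<in>S. h (SOME x. x \<in> \<omega>)) \<in> carrier P"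
    and P_to_H: "\<And>k. k \<in> carrier P \<Longrightarrow>
      (\<lambda>x\<in>E. if orbit G \<phi> x \<in> S then k (orbit G \<phi> x) else \<one>\<^bsub>A\<^esub>) \<in> H"
  shows "(map_semidirect N G E \<phi>)\<lparr>carrier := H \<times> ker_center G E \<phi>\<rparr>
    \<cong> P \<times>\<times> G\<lparr>carrier := ker_center G E \<phi>\<rparr>"
proof -
  let ?r = "\<lambda>h. \<lambda>\<omega>\<in>S. h (SOME x. x \<in> \<omega>)"
  let ?e = "\<lambda>k. \<lambda>x\<in>E. if orbit G \<phi> x \<in> S then k (orbit G \<phi> x) else \<one>\<^bsub>A\<^esub>"
  have some: "(SOME x. x \<in> \<omega>) \<in> \<omega>" "(SOME x. x \<in> \<omega>) \<in> E" "orbit G \<phi> (SOME x. x \<in> \<omega>) = \<omega>"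
    if "\<omega> \<in> S" for \<omega>
    using that S orbits_someI orbits_memD by blast+
  have er: "?e (?r h) = h" if h: "h \<in> H" for h
  proof
    fix x
    have hD: "h \<in> D_tilde A G E \<phi>"
      using h H by blast
    show "?e (?r h) x = h x"
    proof (cases "x \<in> E \<and> orbit G \<phi> x \<in> S")
      case True
      then show ?thesis
        using D_tilde_orbit_eq[OF hD] S some(1) orbit_refl by (auto simp: subset_iff)
    next
      case False
      moreover have "h x = undefined" if "x \<notin> E"
        using hD that by (auto simp: D_tilde_iff intro: PiE_arb)
      ultimately show ?thesis
        using H_one[OF h] by auto
    qed
  qed
  have re: "?r (?e k) = k" if "k \<in> carrier P" for k
    using that P some by (auto simp: extensional_def fun_eq_iff)
  \<comment> \<open>The representatives lie in \<open>E\<close> and are fixed by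
    \<open>\<phi> b2\<close>, so the twist disappears.\<close>
  have hom: "?r (compose E h1 (\<phi> b2) \<otimes>\<^bsub>N\<^esub> h2) = ?r h1 \<otimes>\<^bsub>P\<^esub> ?r h2"
    if "b2 \<in> ker_center G E \<phi>" for h1 h2 b2
    using that some by (auto simp: mult_N mult_P ker_center_iff compose_def fun_eq_iff)
  have "(\<lambda>(h, b). (?r h, b)) \<in> iso ((map_semidirect N G E \<phi>)\<lparr>carrier := H \<times> ker_center G E \<phi>\<rparr>)
      (P \<times>\<times> G\<lparr>carrier := ker_center G E \<phi>\<rparr>)"
  proof (rule isoI)
    show "(\<lambda>(h, b). (?r h, b)) \<in> hom ((map_semidirect N G E \<phi>)\<lparr>carrier := H \<times> ker_center G E \<phi>\<rparr>)
        (P \<times>\<times> G\<lparr>carrier := ker_center G E \<phi>\<rparr>)"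
      using H_to_P by (intro homI) (auto simp: hom)
    have "bij_betw ?r H (carrier P)"
      by (rule bij_betw_byWitness[where f' = ?e]) (use er re H_to_P P_to_H in blast)+
    then have "bij_betw (map_prod ?r id) (H \<times> ker_center G E \<phi>) (carrier P \<times> ker_center G E \<phi>)"
      by (intro bij_betw_map_prod bij_betw_id)
    then show "bij_betw (\<lambda>(h, b). (?r h, b))
        (carrier ((map_semidirect N G E \<phi>)\<lparr>carrier := H \<times> ker_center G E \<phi>\<rparr>))
        (carrier (P \<times>\<times> G\<lparr>carrier := ker_center G E \<phi>\<rparr>))"
      by (simp add: map_prod_def)
  qed
  then show ?thesis
    by (rule is_isoI)
qed

text \<open>A point and its translates have the same orbit, and the default value, the unit, is
  central.\<close>

lemma extend_orbits_in_D_tilde: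
  assumes "group A" "k \<in> S \<rightarrow> center A"
  shows "(\<lambda>x\<in>E. if orbit G \<phi> x \<in> S then k (orbit G \<phi> x) else \<one>\<^bsub>A\<^esub>) \<in> D_tilde A G E \<phi>"
proof -
  have "orbit G \<phi> (\<phi> g x) = orbit G \<phi> x" if "x \<in> E" "g \<in> carrier G" for x g
    using that by (intro orbit_eqI) (auto simp: orbit_def)
  moreover have "\<one>\<^bsub>A\<^esub> \<in> center A"
    using group.subgroup_center[OF assms(1)] by (rule subgroup.one_closed)
  ultimately show ?thesis
    using assms(2) element_image by (auto simp: D_tilde_iff)
qed

text \<open>With \<open>S\<close> the set of all orbits, the default value of the extension is never
  taken on \<open>E\<close>.\<close>

lemma unrestricted_wreath_center_iso:
  assumes "group A"
  shows "(unrestricted_wreath A G E \<phi>)\<lparr>carrier := D_tilde A G E \<phi> \<times> ker_center G E \<phi>\<rparr>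
    \<cong> product_group (orbits G E \<phi>) (\<lambda>_. center_group A) \<times>\<times> G\<lparr>carrier := ker_center G E \<phi>\<rparr>"
  unfolding unrestricted_wreath_def
proof (rule map_semidirect_iso_DirProd)
  fix h assume h: "h \<in> D_tilde A G E \<phi>"
  show "(\<lambda>\<omega>\<in>orbits G E \<phi>. h (SOME x. x \<in> \<omega>))
      \<in> carrier (product_group (orbits G E \<phi>) (\<lambda>_. center_group A))"
    using h orbits_someI orbits_memD(1) by (fastforce simp: D_tilde_iff PiE_iff)
next
  fix k assume "k \<in> carrier (product_group (orbits G E \<phi>) (\<lambda>_. center_group A))"
  then show "(\<lambda>x\<in>E. if orbit G \<phi> x \<in> orbits G E \<phi> then k (orbit G \<phi> x) else \<one>\<^bsub>A\<^esub>)
      \<in> D_tilde A G E \<phi>"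
    using assms by (intro extend_orbits_in_D_tilde) auto
qed (auto simp: orbits_def PiE_iff)

text \<open>Here \<open>S\<close> is the set of finite orbits, and finiteness of support has to be
  carried over in both directions.\<close>

lemma restricted_wreath_center_iso:
  assumes "group A"
  shows "(restricted_wreath A G E \<phi>)\<lparr>carrier := D_fin A G E \<phi> \<times> ker_center G E \<phi>\<rparr>
    \<cong> sum_group (finite_orbits G E \<phi>) (\<lambda>_. center_group A) \<times>\<times> G\<lparr>carrier := ker_center G E \<phi>\<rparr>"
  unfolding restricted_wreath_def
proof (rule map_semidirect_iso_DirProd)
  interpret A: group A by fact
  let ?S = "finite_orbits G E \<phi>"
  show "?S \<subseteq> orbits G E \<phi>"
    by (auto simp: finite_orbits_def)
  show "D_fin A G E \<phi> \<subseteq> D_tilde A G E \<phi>"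
    by (auto simp: D_fin_eq assms)
  show "carrier (sum_group ?S (\<lambda>_. center_group A)) \<subseteq> extensional ?S"
    by (auto simp: carrier_sum_group PiE_iff)
  fix h assume h: "h \<in> D_fin A G E \<phi>"
  then have hD: "h \<in> D_tilde A G E \<phi>" and fin: "finite {x \<in> E. h x \<noteq> \<one>\<^bsub>A\<^esub>}"
    by (auto simp: D_fin_eq assms)
  {
    fix x assume x: "x \<in> E" and notin: "orbit G \<phi> x \<notin> ?S"
    have orb: "orbit G \<phi> x \<in> orbits G E \<phi>"
      using x by (auto simp: orbits_def)
    show "h x = \<one>\<^bsub>A\<^esub>"
    proof (rule ccontr)
      assume "h x \<noteq> \<one>\<^bsub>A\<^esub>"
      \<comment> \<open>By invariance the support contains the whole orbit, which would then be
        finite.\<close>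
      then have "orbit G \<phi> x \<subseteq> {x \<in> E. h x \<noteq> \<one>\<^bsub>A\<^esub>}"
        using D_tilde_orbit_eq[OF hD orb orbit_refl[OF x]] orbits_memD(1)[OF orb] by auto
      then show False
        using fin notin orb finite_subset by (auto simp: finite_orbits_def)
    qed
  }
  let ?r = "\<lambda>\<omega>\<in>?S. h (SOME x. x \<in> \<omega>)"
  have some: "(SOME x. x \<in> \<omega>) \<in> E" "orbit G \<phi> (SOME x. x \<in> \<omega>) = \<omega>" if "\<omega> \<in> ?S" for \<omega>
    using that orbits_someI orbits_memD by (auto simp: finite_orbits_def)
  \<comment> \<open>An orbit with nontrivial value is the orbit of its representative, a point of
    the support of \<open>h\<close>.\<close>
  have "{\<omega> \<in> ?S. ?r \<omega> \<noteq> \<one>\<^bsub>A\<^esub>} \<subseteq> orbit G \<phi> ` {x \<in> E. h x \<noteq> \<one>\<^bsub>A\<^esub>}"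
    using some by (force intro!: image_eqI)
  then have "finite {\<omega> \<in> ?S. ?r \<omega> \<noteq> \<one>\<^bsub>A\<^esub>}"
    using fin finite_surj by blast
  then show "?r \<in> carrier (sum_group ?S (\<lambda>_. center_group A))"
    using hD some by (auto simp: carrier_sum_group D_tilde_iff PiE_iff)
next
  let ?S = "finite_orbits G E \<phi>"
  fix k assume k: "k \<in> carrier (sum_group ?S (\<lambda>_. center_group A))"
  let ?e = "\<lambda>x\<in>E. if orbit G \<phi> x \<in> ?S then k (orbit G \<phi> x) else \<one>\<^bsub>A\<^esub>"
  have k': "k \<in> ?S \<rightarrow> center A" and fin: "finite {\<omega> \<in> ?S. k \<omega> \<noteq> \<one>\<^bsub>A\<^esub>}"
    using k by (auto simp: carrier_sum_group group.group_center_group[OF assms])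
  \<comment> \<open>The support is covered by finitely many orbits, each of them finite.\<close>
  have "{x \<in> E. ?e x \<noteq> \<one>\<^bsub>A\<^esub>} \<subseteq> \<Union>{\<omega> \<in> ?S. k \<omega> \<noteq> \<one>\<^bsub>A\<^esub>}"
    using orbit_refl by (auto split: if_splits)
  moreover have "finite (\<Union>{\<omega> \<in> ?S. k \<omega> \<noteq> \<one>\<^bsub>A\<^esub>})"
    using fin by (auto simp: finite_orbits_def)
  ultimately have "finite {x \<in> E. ?e x \<noteq> \<one>\<^bsub>A\<^esub>}"
    by (rule finite_subset)
  then show "?e \<in> D_fin A G E \<phi>"
    using extend_orbits_in_D_tilde[OF assms k'] by (simp add: D_fin_eq assms)
qed simp_all

end

theorem theorem2p1:
  fixes A :: "('a, 'k) monoid_scheme" and B :: "('b, 'm) monoid_scheme"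
    and X :: "'x set" and \<phi> :: "'b \<Rightarrow> 'x \<Rightarrow> 'x"
  assumes "group A" and "group B" and "group_action B X \<phi>"
    and nondegenerate: "carrier A \<noteq> {\<one>\<^bsub>A\<^esub>} \<or> center B \<subseteq> kernel B (BijGroup X) \<phi>"
  shows
    "center (unrestricted_wreath A B X \<phi>) = D_tilde A B X \<phi> \<times> ker_center B X \<phi> \<and>
     (unrestricted_wreath A B X \<phi>)\<lparr>carrier := D_tilde A B X \<phi> \<times> ker_center B X \<phi>\<rparr>
       \<cong> product_group (orbits B X \<phi>) (\<lambda>_. center_group A) \<times>\<times> B\<lparr>carrier := ker_center B X \<phi>\<rparr> \<and>
     center (restricted_wreath A B X \<phi>) = D_fin A B X \<phi> \<times> ker_center B X \<phi> \<and>
     (restricted_wreath A B X \<phi>)\<lparr>carrier := D_fin A B X \<phi> \<times> ker_center B X \<phi>\<rparr>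
       \<cong> sum_group (finite_orbits B X \<phi>) (\<lambda>_. center_group A) \<times>\<times> B\<lparr>carrier := ker_center B X \<phi>\<rparr>"
proof (intro conjI)
  interpret group_action B X \<phi> by fact
  interpret A: group A by fact
  have "center (unrestricted_wreath A B X \<phi>) =
      (D_tilde A B X \<phi> \<inter> carrier (product_group X (\<lambda>_. A))) \<times> ker_center B X \<phi>"
    unfolding unrestricted_wreath_def
    by (rule center_map_semidirect[OF \<open>group A\<close> nondegenerate]) (auto simp: carrier_sum_group)
  \<comment> \<open>Central values lie in \<open>A\<close>, so intersecting with the group of all
    maps removes nothing.\<close>
  moreover have D_sub: "D_tilde A B X \<phi> \<subseteq> carrier (product_group X (\<lambda>_. A))"
    using subgroup.subset[OF A.subgroup_center] by (simp add: D_tilde_def) blast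
  ultimately show "center (unrestricted_wreath A B X \<phi>) = D_tilde A B X \<phi> \<times> ker_center B X \<phi>"
    by (simp add: Int_absorb2)
  have "center (restricted_wreath A B X \<phi>) =
      (D_tilde A B X \<phi> \<inter> carrier (sum_group X (\<lambda>_. A))) \<times> ker_center B X \<phi>"
    unfolding restricted_wreath_def
    by (rule center_map_semidirect[OF \<open>group A\<close> nondegenerate]) (auto simp: carrier_sum_group)
  \<comment> \<open>\<open>A\<close> and \<open>center_group A\<close> share their unit, so finite
    support means the same for both.\<close>
  moreover have "D_tilde A B X \<phi> \<inter> carrier (sum_group X (\<lambda>_. A)) = D_fin A B X \<phi>"
    using D_sub by (auto simp: D_fin_eq \<open>group A\<close> carrier_sum_group)
  ultimately show "center (restricted_wreath A B X \<phi>) = D_fin A B X \<phi> \<times> ker_center B X \<phi>"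
    by simp
qed (use assms in \<open>auto intro: group_action.unrestricted_wreath_center_iso
  group_action.restricted_wreath_center_iso\<close>)

end
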